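(* Let $L>0$, let $g:\mathbb{R}\to\mathbb{R}$ be continuous and nondecreasing with $g(0)=0$, and let $F:\mathbb{R}\to\mathbb{R}$ be globally Lipschitz continuous with $F(0)=0$. Suppose that $F$ is nonincreasing and that there are positive constants $\alpha_1\le\alpha_2$ and a nonnegative constant $S$ such that $\alpha_1|s|\le|g(s)|\le\alpha_2|s|$ for all $s\in\mathbb{R}$ with $|s|\ge S$. Let $E_S\ge0$, $M>0$, $\mu>0$ be constants (they exist under these hypotheses) such that every weak solution $\mathbf{u}$ of the system (P) satisfies $$\{\mathcal{E}^{\mathbf{u}}(t)-E_S\}^+\le M\exp(-\mu t)\{\mathcal{E}^{\mathbf{u}}(0)-E_S\}^+\quad\text{for all }t\ge0.$$ Then the set $$\mathfrak{B}=\{[\mathbf{u},\mathbf{v}]\in\mathcal{H}:\mathcal{E}(\mathbf{u},\mathbf{v})\le E_S\}$$ is positively invariant (every weak solution starting in $\mathfrak{B}$ remains in $\mathfrak{B}$ for all $t\ge0$), and there exists a constant $M'>0$ such that, for every weak solution $\mathbf{u}$ of (P) and all $t\ge0$, $$\operatorname{dist}([\mathbf{u}(t),\mathbf{u}'(t)],\mathfrak{B})^2\le M'\exp(-\mu t)\{\mathcal{E}^{\mathbf{u}}(0)-E_S\}^+ .$$ (System (P), weak solutions, $\mathcal{H}$, $\mathcal{E}$ and $\mathcal{E}^{\mathbf{u}}$ are defined in the context.)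
   Context: Setting. Let $\Omega=(0,L)$. System (P) is $$\partial_{tt}u-\partial_{xx}u=0 \text{ on }\Omega\times\mathbb{R}^+,\qquad \partial_{tt}u(0,t)-\partial_xu(0,t)=F(\partial_tu(0,t)),\qquad \partial_xu(L,t)=-g(\partial_tu(L,t)).$$ Spaces. $H=L^2(\Omega)\times\mathbb{R}$ with scalar product $((u_1,\theta_1),(u_2,\theta_2))_H=\int_\Omega u_1u_2\,dx+\theta_1\theta_2$. $V=\{(u,u(0)):u\in H^1(\Omega)\}$, a closed subspace of $H^1(\Omega)\times\mathbb{R}$, with the inherited scalar product, so $\|\mathbf{u}\|_V^2=\|u\|_{L^2(\Omega)}^2+\|\partial_xu\|_{L^2(\Omega)}^2+|u(0)|^2$. $\mathcal{H}=V\times H$ with $\|[\mathbf{u},\mathbf{v}]\|_{\mathcal{H}}^2=\|\mathbf{u}\|_V^2+\|\mathbf{v}\|_H^2$. Elements of $H$ are written $\mathbf{v}=(v,\theta)$, elements of $V$ are written $\mathbf{u}=(u,u(0))$, and elements of $\mathcal{H}$ are written $[\mathbf{u},\mathbf{v}]$. $W=\{\mathbf{u}\in V:u\in H^2(\Omega)\}$. For $\mathbf{X}\in\mathcal{H}$ and $B\subset\mathcal{H}$, $\operatorname{dist}(\mathbf{X},B)=\inf_{\mathbf{Y}\in B}\|\mathbf{X}-\mathbf{Y}\|_{\mathcal{H}}$. Cauchy problem. (P) is recast as $\dot{\mathbf{X}}(t)+\mathcal{A}_g(\mathbf{X}(t))=\mathcal{F}(\mathbf{X}(t))$, $\mathbf{X}(0)=\mathbf{X}^0$,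 where $\mathbf{X}=[\mathbf{u},\mathbf{v}]$ with $\mathbf{v}=\mathbf{u}'$, $\mathcal{D}(\mathcal{A}_g)=\{[\mathbf{u},\mathbf{v}]\in W\times V:\partial_xu(L)=-g(v(L))\}$, $\mathcal{A}_g([\mathbf{u},\mathbf{v}])=-[\mathbf{v},(\partial_{xx}u,\partial_xu(0))]$, and $\mathcal{F}([\mathbf{u},(v,\theta)])=[0,(0,F(\theta))]$. Solutions. A strong solution is a (locally) absolutely continuous $\mathcal{H}$-valued function on $\mathbb{R}^+$ satisfying the differential equation for a.e. $t\ge0$, with initial data in $\mathcal{D}(\mathcal{A}_g)$. A weak solution, with initial data in $\mathcal{H}$, is a limit of strong solutions in $\mathcal{C}([0,T],\mathcal{H})$ for every $T>0$. It is known that for every $[\mathbf{u}^0,\mathbf{v}^0]\in\mathcal{H}$ there is a unique weak solution $[\mathbf{u},\mathbf{u}']$, with $\mathbf{u}\in\mathcal{C}(\mathbb{R}^+,V)\cap\mathcal{C}^1(\mathbb{R}^+,H)$; one calls $\mathbf{u}$ itself the weak solution. Energy. For $[\mathbf{u},\mathbf{v}]\in\mathcal{H}$, $\mathcal{E}(\mathbf{u},\mathbf{v})=\frac12\left\{\int_\Omega|\partial_xu|^2dx+\|\mathbf{v}\|_H^2\right\}$. For a weak solution $\mathbf{u}$, $\mathcal{E}^{\mathbf{u}}(t)=\mathcal{E}(\mathbf{u}(t),\mathbf{u}'(t))$. For real $s$, $s^+=\max\{s,0\}$. *)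

theory Defs
  imports "HOL-Analysis.Analysis" "HOL-Library.Function_Algebras"
begin

text \<open>
  Function spaces over the interval \<open>(0, L)\<close> are sets of functions \<open>real \<Rightarrow> real\<close>. No quotient by
  almost everywhere equality is taken: a function represents its class on \<open>(0, L)\<close>, its values
  outside the interval are irrelevant, and the norms below are seminorms on representatives.
  Limits, derivatives in time and distances only refer to these seminorms.
\<close>

instantiation "fun" :: (type, real_vector) real_vector
begin

definition scaleR_fun :: "real \<Rightarrow> ('a \<Rightarrow> 'b) \<Rightarrow> 'a \<Rightarrow> 'b" where
  "scaleR_fun r f = (\<lambda>x. r *\<^sub>R f x)"

instance
  by standard (simp_all add: scaleR_fun_def fun_eq_iff algebra_simps)

end

definition Omega :: "real \<Rightarrow> real set" where
  "Omega L = {0<..<L}"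

definition L2_space :: "real \<Rightarrow> (real \<Rightarrow> real) set" where
  "L2_space L = {f. f \<in> borel_measurable (lebesgue_on (Omega L)) \<and>
                    integrable (lebesgue_on (Omega L)) (\<lambda>x. (f x)\<^sup>2)}"

definition L2_inner :: "real \<Rightarrow> (real \<Rightarrow> real) \<Rightarrow> (real \<Rightarrow> real) \<Rightarrow> real" where
  "L2_inner L f h = (LINT x|lebesgue_on (Omega L). f x * h x)"

text \<open>Weak derivatives are tested against \<open>C\<^sup>1\<close> functions with compact support in \<open>(0, L)\<close>.\<close>

definition test_function :: "real \<Rightarrow> (real \<Rightarrow> real) \<Rightarrow> bool" where
  "test_function L \<phi> \<longleftrightarrow>
     \<phi> C1_differentiable_on UNIV \<and>
     (\<exists>K. compact K \<and> K \<subseteq> Omega L \<and> (\<forall>x. x \<notin> K \<longrightarrow> \<phi> x = 0))"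

definition is_weak_derivative :: "real \<Rightarrow> (real \<Rightarrow> real) \<Rightarrow> (real \<Rightarrow> real) \<Rightarrow> bool" where
  "is_weak_derivative L u w \<longleftrightarrow>
     w \<in> L2_space L \<and>
     (\<forall>\<phi>. test_function L \<phi> \<longrightarrow> L2_inner L u (deriv \<phi>) = - L2_inner L w \<phi>)"

definition H1_space :: "real \<Rightarrow> (real \<Rightarrow> real) set" where
  "H1_space L = {u \<in> L2_space L. \<exists>w. is_weak_derivative L u w}"

text \<open>A representative of the weak derivative, which is unique up to null sets.\<close>

definition dx :: "real \<Rightarrow> (real \<Rightarrow> real) \<Rightarrow> real \<Rightarrow> real" where
  "dx L u = (SOME w. is_weak_derivative L u w)"

definition H2_space :: "real \<Rightarrow> (real \<Rightarrow> real) set" where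
  "H2_space L = {u \<in> H1_space L. dx L u \<in> H1_space L}"

text \<open>
  The value of a Sobolev function at a point \<open>a\<close> of \<open>[0, L]\<close> is that of the representative which is
  continuous on \<open>[0, L]\<close>. This representative is unique on \<open>[0, L]\<close> if \<open>L > 0\<close>, and it exists for
  every element of \<open>H1_space L\<close>.
\<close>

definition pt_value :: "real \<Rightarrow> (real \<Rightarrow> real) \<Rightarrow> real \<Rightarrow> real" where
  "pt_value L u a =
     (THE y. \<exists>w. continuous_on {0..L} w \<and> (AE x in lebesgue_on (Omega L). u x = w x) \<and> w a = y)"

type_synonym elt = "(real \<Rightarrow> real) \<times> real"
type_synonym state = "elt \<times> elt"

definition H_space :: "real \<Rightarrow> elt set" where
  "H_space L = L2_space L \<times> UNIV"

definition inner_H :: "real \<Rightarrow> elt \<Rightarrow> elt \<Rightarrow> real" where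
  "inner_H L v w = L2_inner L (fst v) (fst w) + snd v * snd w"

definition norm_H :: "real \<Rightarrow> elt \<Rightarrow> real" where
  "norm_H L v = sqrt (inner_H L v v)"

definition V_space :: "real \<Rightarrow> elt set" where
  "V_space L = {(u, pt_value L u 0) |u. u \<in> H1_space L}"

definition inner_V :: "real \<Rightarrow> elt \<Rightarrow> elt \<Rightarrow> real" where
  "inner_V L u w =
     L2_inner L (fst u) (fst w) + L2_inner L (dx L (fst u)) (dx L (fst w)) + snd u * snd w"

definition norm_V :: "real \<Rightarrow> elt \<Rightarrow> real" where
  "norm_V L u = sqrt (inner_V L u u)"

definition W_space :: "real \<Rightarrow> elt set" where
  "W_space L = {u \<in> V_space L. fst u \<in> H2_space L}"

definition HH_space :: "real \<Rightarrow> state set" where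
  "HH_space L = V_space L \<times> H_space L"

definition norm_HH :: "real \<Rightarrow> state \<Rightarrow> real" where
  "norm_HH L X = sqrt ((norm_V L (fst X))\<^sup>2 + (norm_H L (snd X))\<^sup>2)"

definition dist_HH :: "real \<Rightarrow> state \<Rightarrow> state set \<Rightarrow> real" where
  "dist_HH L X B = (INF Y\<in>B. norm_HH L (X - Y))"

definition dom_A :: "real \<Rightarrow> (real \<Rightarrow> real) \<Rightarrow> state set" where
  "dom_A L g = {(u, v). u \<in> W_space L \<and> v \<in> V_space L \<and>
                        pt_value L (dx L (fst u)) L = - g (pt_value L (fst v) L)}"

definition op_A :: "real \<Rightarrow> state \<Rightarrow> state" where
  "op_A L = (\<lambda>(u, v). - (v, (dx L (dx L (fst u)), pt_value L (dx L (fst u)) 0)))"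

definition op_F :: "(real \<Rightarrow> real) \<Rightarrow> state \<Rightarrow> state" where
  "op_F F = (\<lambda>(u, (v, \<theta>)). (0, (0, F \<theta>)))"

text \<open>The parameter \<open>N\<close> of the next two notions is a seminorm. Time runs over \<open>[0, \<infinity>)\<close>.\<close>

definition has_time_derivative ::
    "('a::real_vector \<Rightarrow> real) \<Rightarrow> (real \<Rightarrow> 'a) \<Rightarrow> 'a \<Rightarrow> real \<Rightarrow> bool" where
  "has_time_derivative N X D t \<longleftrightarrow>
     ((\<lambda>s. N ((X s - X t) /\<^sub>R (s - t) - D)) \<longlongrightarrow> 0) (at t within {0..})"

definition loc_abs_continuous :: "('a::real_vector \<Rightarrow> real) \<Rightarrow> (real \<Rightarrow> 'a) \<Rightarrow> bool" where
  "loc_abs_continuous N X \<longleftrightarrow>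
     (\<forall>T>0. \<forall>\<epsilon>>0. \<exists>\<delta>>0. \<forall>(n::nat) a b.
        (\<forall>i<n. 0 \<le> a i \<and> a i \<le> b i \<and> b i \<le> T) \<longrightarrow>
        disjoint_family_on (\<lambda>i. {a i<..<b i}) {..<n} \<longrightarrow>
        (\<Sum>i<n. b i - a i) < \<delta> \<longrightarrow>
        (\<Sum>i<n. N (X (b i) - X (a i))) < \<epsilon>)"

definition strong_solution ::
    "real \<Rightarrow> (real \<Rightarrow> real) \<Rightarrow> (real \<Rightarrow> real) \<Rightarrow> (real \<Rightarrow> state) \<Rightarrow> bool" where
  "strong_solution L g F X \<longleftrightarrow>
     (\<forall>t\<ge>0. X t \<in> HH_space L) \<and>
     loc_abs_continuous (norm_HH L) X \<and>
     X 0 \<in> dom_A L g \<and>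
     (AE t in lebesgue_on {0..}. X t \<in> dom_A L g \<and>
        has_time_derivative (norm_HH L) X (op_F F (X t) - op_A L (X t)) t)"

definition weak_solution_Cauchy ::
    "real \<Rightarrow> (real \<Rightarrow> real) \<Rightarrow> (real \<Rightarrow> real) \<Rightarrow> (real \<Rightarrow> state) \<Rightarrow> bool" where
  "weak_solution_Cauchy L g F X \<longleftrightarrow>
     (\<forall>t\<ge>0. X t \<in> HH_space L) \<and>
     (\<exists>Y. (\<forall>n. strong_solution L g F (Y n)) \<and>
          (\<forall>T>0. \<forall>\<epsilon>>0. \<exists>N::nat. \<forall>n\<ge>N. \<forall>t\<in>{0..T}. norm_HH L (Y n t - X t) < \<epsilon>))"

text \<open>
  The pair \<open>[u, u']\<close> solves the Cauchy problem weakly and \<open>u'\<close> is the derivative of \<open>u\<close> as an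
  \<open>H\<close>-valued function. Continuity of \<open>u\<close> in \<open>V\<close> and of \<open>u'\<close> in \<open>H\<close> follows from the locally uniform
  approximation by strong solutions.
\<close>

definition weak_solution ::
    "real \<Rightarrow> (real \<Rightarrow> real) \<Rightarrow> (real \<Rightarrow> real) \<Rightarrow> (real \<Rightarrow> elt) \<Rightarrow> (real \<Rightarrow> elt) \<Rightarrow> bool" where
  "weak_solution L g F u u' \<longleftrightarrow>
     weak_solution_Cauchy L g F (\<lambda>t. (u t, u' t)) \<and>
     (\<forall>t\<ge>0. has_time_derivative (norm_H L) u (u' t) t)"

definition energy :: "real \<Rightarrow> elt \<Rightarrow> elt \<Rightarrow> real" where
  "energy L u v =
     1/2 * ((LINT x|lebesgue_on (Omega L). \<bar>dx L (fst u) x\<bar>\<^sup>2) + (norm_H L v)\<^sup>2)"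

definition pos_part :: "real \<Rightarrow> real" where
  "pos_part s = max s 0"

definition energy_ball :: "real \<Rightarrow> real \<Rightarrow> state set" where
  "energy_ball L E = {(u, v). (u, v) \<in> HH_space L \<and> energy L u v \<le> E}"

end

theory Submission
  imports Defs
begin

text \<open>
  Positive invariance is the decay estimate with vanishing right-hand side. For the distance, shrink
  a state \<open>[u, v]\<close> of energy \<open>e > E\<close> towards the equilibrium \<open>[c, 0]\<close> with \<open>c = u(0)\<close>, by the factor
  \<open>a = sqrt (E / e)\<close>. The energy does not see constants and is quadratic, so the result has energy
  \<open>E\<close>; by the Poincare inequality for \<open>u - u(0)\<close> the squared displacement is at most
  \<open>2 (L\<^sup>2 + 1) (1 - a)\<^sup>2 e\<close>, and \<open>(1 - a)\<^sup>2 e \<le> (1 - a\<^sup>2) e = e - E\<close>.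
  Since \<open>dx\<close> and \<open>pt_value\<close> are choices of representatives, all this rests on the fact that a function
  in \<open>H\<^sup>1\<close> agrees almost everywhere with a constant plus the primitive of its weak derivative.
\<close>

section \<open>Functions determined by their integrals over initial segments\<close>

text \<open>Differences of the vanishing integrals give a zero integral over every compact
  subinterval, and Lebesgue differentiation recovers the function from such averages off a
  negligible set.\<close>

lemma AE_zero_if_integrals_zero:
  fixes h :: "real \<Rightarrow> real"
  assumes int: "integrable (lebesgue_on {p<..<q}) h"
    and zero: "\<And>a. a \<in> {p<..<q} \<Longrightarrow> (LINT s|lebesgue_on {p<..<q}. indicator {..<a} s * h s) = 0"
  shows "AE x in lebesgue_on {p<..<q}. h x = 0"
proof -
  define f where "f = (\<lambda>x. indicator {p<..<q} x * h x)"
  have f_int: "integrable lebesgue f"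
    using int by (simp add: integrable_restrict_space f_def)
  have f_iv: "set_integrable lebesgue {a..b} f" for a b
    using integrable_mult_indicator[OF _ f_int, of "{a..b}"] by (simp add: set_integrable_def)
  have f_cbox: "f integrable_on cbox a b" for a b
    using set_lebesgue_integral_eq_integral(1)[OF f_iv] by simp
  have cut: "(LINT s|lebesgue. indicator {..<a} s * f s) = 0" if "a \<in> {p<..<q}" for a
  proof -
    have "(LINT s|lebesgue. indicator {..<a} s * f s)
        = (LINT s|lebesgue_on {p<..<q}. indicator {..<a} s * h s)"
      by (subst integral_restrict_space) (auto simp: f_def mult_ac)
    then show ?thesis using zero[OF that] by simp
  qed
  have zero_iv: "integral {a..b} f = 0" if "p < a" "a \<le> b" "b < q" for a b
  proof -
    have i: "integrable lebesgue (\<lambda>s. indicator {..<c} s * f s)" for c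
      using integrable_mult_indicator[OF _ f_int, of "{..<c}"] by simp
    have "integral {a..b} f = (LINT s|lebesgue. indicator {a..b} s * f s)"
      using set_lebesgue_integral_eq_integral(2)[OF f_iv[of a b]]
      by (simp add: set_lebesgue_integral_def)
    \<comment> \<open>The difference of the two indicators is that of \<open>{a..<b}\<close>, so it
      misses the closed interval only at the null point \<open>b\<close>.\<close>
    also have "\<dots> = (LINT s|lebesgue. indicator {..<b} s * f s - indicator {..<a} s * f s)"
    proof (rule integral_cong_AE)
      have "AE s in lebesgue. s \<noteq> b"
        by (simp add: AE_iff_null_sets completion.AE_iff_null_sets)
      then show "AE s in lebesgue. indicator {a..b} s * f s
                  = indicator {..<b} s * f s - indicator {..<a} s * f s"
        by eventually_elim (use that in \<open>auto split: split_indicator\<close>)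
    next
      show "(\<lambda>s. indicator {a..b} s * f s) \<in> borel_measurable lebesgue"
        using f_iv[of a b] by (auto simp: set_integrable_def)
    next
      show "(\<lambda>s. indicator {..<b} s * f s - indicator {..<a} s * f s) \<in> borel_measurable lebesgue"
        using i[of a] i[of b] by auto
    qed
    also have "\<dots> = 0"
      using i[of a] i[of b] cut[of a] cut[of b] that by simp
    finally show ?thesis .
  qed
  obtain N where N: "negligible N" and lim: "\<And>x e. x \<notin> N \<Longrightarrow> 0 < e \<Longrightarrow>
      \<exists>d>0. \<forall>t. 0 < t \<and> t < d \<longrightarrow>
        norm (integral (cbox x (x + t *\<^sub>R One)) f /\<^sub>R t ^ DIM(real) - f x) < e"
    using integrable_ccontinuous_explicit[OF f_cbox] by metis
  have f0: "f x = 0" if x: "x \<notin> N" "x \<in> {p<..<q}" for x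
  proof (rule ccontr)
    assume "f x \<noteq> 0"
    then obtain d where d: "d > 0" and dd: "\<And>t. 0 < t \<Longrightarrow> t < d \<Longrightarrow>
        norm (integral {x..x+t} f / t - f x) < \<bar>f x\<bar>"
      using lim[OF x(1), of "\<bar>f x\<bar>"] by (auto simp: divide_inverse mult.commute)
    \<comment> \<open>Small enough for the averages to be close to \<open>f x\<close>, and for
      \<open>{x..x+t}\<close> to stay inside the open interval, where the average is zero.\<close>
    define t where "t = min (d/2) ((q - x)/2)"
    have t: "0 < t" "t < d" "x + t < q" using d x by (auto simp: t_def min_def field_simps)
    show False using dd[OF t(1,2)] zero_iv[of x "x+t"] t x by simp
  qed
  have "AE x in lebesgue. x \<notin> N"
    using N by (simp add: negligible_iff_null_sets AE_not_in)
  then have "AE x in lebesgue. x \<in> {p<..<q} \<longrightarrow> h x = 0"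
    by eventually_elim (use f0 in \<open>auto simp: f_def\<close>)
  then show ?thesis by (subst AE_restrict_space_iff) auto
qed

section \<open>Primitives of integrable functions\<close>

text \<open>Cutting off the integrand instead of the domain keeps the measure independent of
  \<open>x\<close>, which suits dominated convergence and Fubini. The function is defined on all of
  the real line and is constant on either side of \<open>Omega L\<close>.\<close>

definition primitive :: "real \<Rightarrow> (real \<Rightarrow> real) \<Rightarrow> real \<Rightarrow> real" where
  "primitive L w x = (LINT s|lebesgue_on (Omega L). indicator {..<x} s * w s)"

lemma Omega_sets [simp]: "Omega L \<in> sets lebesgue"
  by (simp add: Omega_def)

lemma finite_measure_Omega: "finite_measure (lebesgue_on (Omega L))"
  by (rule finite_measure_lebesgue_on) (simp add: Omega_def)

lemma integrable_cut:
  fixes w :: "real \<Rightarrow> real"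
  assumes "integrable (lebesgue_on (Omega L)) w"
  shows "integrable (lebesgue_on (Omega L)) (\<lambda>s. indicator {..<x} s * w s)"
proof -
  have "{..<x} \<inter> Omega L \<in> sets (lebesgue_on (Omega L))"
    by (simp add: sets_restrict_space_iff Omega_def)
  then have "integrable (lebesgue_on (Omega L)) (\<lambda>s. indicator ({..<x} \<inter> Omega L) s *\<^sub>R w s)"
    by (rule integrable_mult_indicator) fact
  then show ?thesis
    by (rule Bochner_Integration.integrable_cong[THEN iffD1, rotated 2]) (auto split: split_indicator)
qed

text \<open>Dominated convergence with majorant \<open>\<bar>w s\<bar>\<close>: along a sequence
  tending to \<open>a\<close>, the cut-offs are eventually constant at every \<open>s\<close> other
  than \<open>a\<close>.\<close>

lemma continuous_primitive:
  assumes w: "integrable (lebesgue_on (Omega L)) w"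
  shows "continuous_on UNIV (primitive L w)"
  unfolding continuous_on_sequentially
proof (intro allI ballI impI)
  fix X :: "nat \<Rightarrow> real" and a assume X: "(\<forall>n. X n \<in> UNIV) \<and> X \<longlonglongrightarrow> a"
  have "(\<lambda>n. primitive L w (X n)) \<longlonglongrightarrow> primitive L w a"
    unfolding primitive_def
  proof (rule integral_dominated_convergence[where w = "\<lambda>s. \<bar>w s\<bar>"])
    have "AE s in lebesgue. s \<noteq> a"
      by (simp add: completion.AE_iff_null_sets)
    then have "AE s in lebesgue_on (Omega L). s \<noteq> a"
      by (subst AE_restrict_space_iff) auto
    then show "AE s in lebesgue_on (Omega L).
        (\<lambda>n. indicator {..<X n} s * w s) \<longlonglongrightarrow> indicator {..<a} s * w s"
    proof eventually_elim
      case (elim s)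
      then consider "s < a" | "a < s" by linarith
      then have "\<forall>\<^sub>F n in sequentially. indicator {..<X n} s * w s = indicator {..<a} s * w s"
      proof cases
        case 1
        then have "\<forall>\<^sub>F n in sequentially. s < X n" using order_tendstoD(1) X by blast
        then show ?thesis by eventually_elim (use 1 in auto)
      next
        case 2
        then have "\<forall>\<^sub>F n in sequentially. X n < s" using order_tendstoD(2) X by blast
        then show ?thesis by eventually_elim (use 2 in auto)
      qed
      then show ?case by (rule tendsto_eventually)
    qed
  qed (use w integrable_cut[OF w] in \<open>auto split: split_indicator\<close>)
  then show "(primitive L w \<circ> X) \<longlonglongrightarrow> primitive L w a" by (simp add: o_def)
qed

section \<open>Test functions and integration by parts\<close>

lemma test_function_deriv:
  assumes "test_function L \<phi>"
  shows "(\<phi> has_real_derivative deriv \<phi> x) (at x)" "continuous_on UNIV (deriv \<phi>)"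
proof -
  obtain D where D: "\<And>x. (\<phi> has_vector_derivative D x) (at x)" "continuous_on UNIV D"
    using assms by (auto simp: test_function_def C1_differentiable_on_def)
  have "deriv \<phi> = D"
    using D(1) by (auto intro!: ext DERIV_imp_deriv simp: has_real_derivative_iff_has_vector_derivative)
  with D show "(\<phi> has_real_derivative deriv \<phi> x) (at x)" "continuous_on UNIV (deriv \<phi>)"
    by (auto simp: has_real_derivative_iff_has_vector_derivative)
qed

lemma test_function_outside:
  assumes "test_function L \<phi>" "x \<notin> Omega L"
  shows "\<phi> x = 0"
  using assms by (auto simp: test_function_def)

lemma bounded_on_Omega:
  fixes f :: "real \<Rightarrow> real"
  assumes "continuous_on {0..L} f"
  obtains B where "0 \<le> B" "\<And>x. x \<in> Omega L \<Longrightarrow> \<bar>f x\<bar> \<le> B"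
proof -
  have "bounded (f ` {0..L})"
    using assms by (intro compact_imp_bounded compact_continuous_image) auto
  then obtain B where "\<forall>x\<in>{0..L}. \<bar>f x\<bar> \<le> B" by (auto simp only: bounded_iff ball_simps real_norm_def)
  moreover have "x \<in> {0..L}" if "x \<in> Omega L" for x
    using that by (simp add: Omega_def)
  ultimately have "\<bar>f x\<bar> \<le> \<bar>B\<bar>" if "x \<in> Omega L" for x
    using that by (meson abs_ge_self order_trans)
  then show ?thesis using that[of "\<bar>B\<bar>"] by auto
qed

lemma measurable_continuous_Omega:
  fixes f :: "real \<Rightarrow> real"
  assumes "continuous_on {0..L} f"
  shows "f \<in> borel_measurable (lebesgue_on (Omega L))"
  by (rule continuous_imp_measurable_on_sets_lebesgue)
     (auto simp: Omega_def intro: continuous_on_subset[OF assms])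

lemma integrable_mult_continuous:
  fixes h f :: "real \<Rightarrow> real"
  assumes h: "integrable (lebesgue_on (Omega L)) h" and f: "continuous_on {0..L} f"
  shows "integrable (lebesgue_on (Omega L)) (\<lambda>x. h x * f x)"
proof -
  obtain B where B: "\<And>x. x \<in> Omega L \<Longrightarrow> \<bar>f x\<bar> \<le> B" using bounded_on_Omega[OF f] by blast
  show ?thesis
  proof (rule Bochner_Integration.integrable_bound[where f = "\<lambda>x. B * h x"])
    show "AE x in lebesgue_on (Omega L). norm (h x * f x) \<le> norm (B * h x)"
    proof (rule AE_I2)
      fix x assume "x \<in> space (lebesgue_on (Omega L))"
      then have "\<bar>f x\<bar> \<le> \<bar>B\<bar>" using B[of x] by simp
      then show "norm (h x * f x) \<le> norm (B * h x)"
        by (simp add: abs_mult mult_mono mult.commute)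
    qed
  qed (use h measurable_continuous_Omega[OF f] in auto)
qed

lemma integrable_const_Omega: "integrable (lebesgue_on (Omega L)) (\<lambda>x. c::real)"
  by (rule finite_measure.integrable_const[OF finite_measure_Omega])

text \<open>The fundamental theorem of calculus, with no boundary term at \<open>L\<close> because
  the support is compact in the open interval. This is the inner integral left after exchanging the
  order of integration below.\<close>

lemma integral_deriv_tail:
  assumes \<phi>: "test_function L \<phi>" and s: "0 \<le> s" "s \<le> L"
  shows "(LINT x|lebesgue_on (Omega L). indicator {s<..} x * deriv \<phi> x) = - \<phi> s"
proof -
  have "(LINT x|lebesgue_on (Omega L). indicator {s<..} x * deriv \<phi> x)
      = (LINT x|lebesgue. indicator {s<..<L} x * deriv \<phi> x)"
    using s by (subst integral_restrict_space)
      (auto simp: Omega_def intro!: Bochner_Integration.integral_cong split: split_indicator)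
  also have "\<dots> = (LINT x|lebesgue. indicator {s..L} x * deriv \<phi> x)"
  proof (rule integral_cong_AE)
    have m: "deriv \<phi> \<in> borel_measurable lebesgue"
      using test_function_deriv(2)[OF \<phi>]
      using continuous_imp_measurable_on_sets_lebesgue[of UNIV "deriv \<phi>"]
      by (simp add: lebesgue_on_UNIV_eq)
    show "(\<lambda>x. indicator {s<..<L} x * deriv \<phi> x) \<in> borel_measurable lebesgue"
      "(\<lambda>x. indicator {s..L} x * deriv \<phi> x) \<in> borel_measurable lebesgue"
      using m by (auto intro!: borel_measurable_times borel_measurable_indicator)
    have "AE x in lebesgue. x \<noteq> s" "AE x in lebesgue. x \<noteq> L"
      by (simp_all add: completion.AE_iff_null_sets)
    then show "AE x in lebesgue. indicator {s<..<L} x * deriv \<phi> x = indicator {s..L} x * deriv \<phi> x"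
      by eventually_elim (auto split: split_indicator)
  qed
  also have "\<dots> = (LINT x|lebesgue_on {s..L}. deriv \<phi> x)"
    by (subst integral_restrict_space) auto
  also have "\<dots> = integral {s..L} (deriv \<phi>)"
    by (intro lebesgue_integral_eq_integral continuous_imp_integrable_real
          continuous_on_subset[OF test_function_deriv(2)[OF \<phi>]]) auto
  also have "\<dots> = \<phi> L - \<phi> s"
    using s test_function_deriv(1)[OF \<phi>]
    by (intro integral_unique fundamental_theorem_of_calculus)
       (auto simp: has_real_derivative_iff_has_vector_derivative intro: has_vector_derivative_at_within)
  finally show ?thesis using test_function_outside[OF \<phi>, of L] by (simp add: Omega_def)
qed

text \<open>Integration by parts for a merely integrable \<open>w\<close>: no pointwise derivative
  of the primitive is taken. Both sides are iterated integrals of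
  \<open>w s * deriv \<phi> x\<close> over the triangle \<open>s < x\<close>, and Fubini exchanges
  the order.\<close>

lemma integral_primitive_deriv:
  assumes \<phi>: "test_function L \<phi>" and w: "integrable (lebesgue_on (Omega L)) w"
  shows "(LINT x|lebesgue_on (Omega L). primitive L w x * deriv \<phi> x)
       = - (LINT s|lebesgue_on (Omega L). w s * \<phi> s)"
proof -
  let ?M = "lebesgue_on (Omega L)"
  interpret M: finite_measure ?M by (rule finite_measure_Omega)
  interpret MM: pair_sigma_finite ?M ?M ..
  have cont: "continuous_on {0..L} (deriv \<phi>)"
    using test_function_deriv(2)[OF \<phi>] continuous_on_subset by blast
  \<comment> \<open>Measurability of the identity into the Borel sets makes the condition
    \<open>s < x\<close> measurable on the product space.\<close>
  have [measurable]: "w \<in> borel_measurable ?M" "deriv \<phi> \<in> borel_measurable ?M"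
      "(\<lambda>x. x) \<in> borel_measurable ?M"
    using w measurable_continuous_Omega[OF cont] measurable_continuous_Omega[of L "\<lambda>x. x"] by auto
  obtain B where B: "0 \<le> B" "\<And>x. x \<in> Omega L \<Longrightarrow> \<bar>deriv \<phi> x\<bar> \<le> B"
    using bounded_on_Omega[OF cont] by blast
  define f where "f s x = w s * ((if s < x then 1 else 0) * deriv \<phi> x)" for s x
  \<comment> \<open>The majorant for Fubini: \<open>B\<close> bounds \<open>deriv \<phi>\<close>,
    and a constant in \<open>x\<close> is integrable because \<open>?M\<close> is finite.\<close>
  have "integrable (?M \<Otimes>\<^sub>M ?M) (\<lambda>(s, x). w s * B)"
    by (rule MM.Fubini_integrable) (use w in auto)
  then have f_int: "integrable (?M \<Otimes>\<^sub>M ?M) (case_prod f)"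
  proof (rule Bochner_Integration.integrable_bound)
    show "case_prod f \<in> borel_measurable (?M \<Otimes>\<^sub>M ?M)"
      unfolding f_def by measurable
    show "AE p in ?M \<Otimes>\<^sub>M ?M. norm (case_prod f p) \<le> norm (case p of (s, x) \<Rightarrow> w s * B)"
    proof (rule AE_I2)
      fix p assume "p \<in> space (?M \<Otimes>\<^sub>M ?M)"
      then have "snd p \<in> Omega L" by (auto simp: space_pair_measure)
      then have "\<bar>deriv \<phi> (snd p)\<bar> \<le> \<bar>B\<bar>" using B(2) by fastforce
      then show "norm (case_prod f p) \<le> norm (case p of (s, x) \<Rightarrow> w s * B)"
        by (cases p) (auto simp: f_def abs_mult intro: mult_left_mono)
    qed
  qed
  have "(LINT x|?M. primitive L w x * deriv \<phi> x) = (LINT x|?M. LINT s|?M. f s x)"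
  proof (rule Bochner_Integration.integral_cong)
    fix x assume "x \<in> space ?M"
    have "(LINT s|?M. f s x) = (LINT s|?M. (indicator {..<x} s * w s) * deriv \<phi> x)"
      by (rule Bochner_Integration.integral_cong) (auto simp: f_def)
    also have "\<dots> = primitive L w x * deriv \<phi> x"
      by (simp add: primitive_def)
    finally show "primitive L w x * deriv \<phi> x = (LINT s|?M. f s x)" ..
  qed simp
  also have "\<dots> = (LINT s|?M. LINT x|?M. f s x)"
    by (rule MM.Fubini_integral[OF f_int])
  also have "\<dots> = (LINT s|?M. - (w s * \<phi> s))"
  proof (rule Bochner_Integration.integral_cong)
    fix s assume "s \<in> space ?M"
    then have s: "0 \<le> s" "s \<le> L" by (auto simp: Omega_def)
    have "(LINT x|?M. f s x) = (LINT x|?M. w s * (indicator {s<..} x * deriv \<phi> x))"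
      by (rule Bochner_Integration.integral_cong) (auto simp: f_def)
    also have "\<dots> = - (w s * \<phi> s)"
      by (simp add: integral_deriv_tail[OF \<phi> s])
    finally show "(LINT x|?M. f s x) = - (w s * \<phi> s)" .
  qed simp
  finally show ?thesis by simp
qed

section \<open>The lemma of du Bois-Reymond\<close>

text \<open>The antiderivative vanishing at 0 is constant wherever \<open>\<eta>\<close> vanishes.
  It is therefore 0 to the left of \<open>p\<close>, and the zero mean carries the value 0 over to
  the right of \<open>q\<close>.\<close>

lemma test_function_antiderivative:
  fixes \<eta> :: "real \<Rightarrow> real"
  assumes L: "L > 0" and cont: "continuous_on UNIV \<eta>" and pq: "0 < p" "p \<le> q" "q < L"
    and supp: "\<And>x. x \<notin> {p..q} \<Longrightarrow> \<eta> x = 0"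
    and zero: "(LINT x|lebesgue_on (Omega L). \<eta> x) = 0"
  obtains \<phi> where "test_function L \<phi>" "deriv \<phi> = \<eta>"
proof -
  obtain F where F: "\<And>x. (F has_vector_derivative \<eta> x) (at x)"
    using einterval_antiderivative[of "-\<infinity>" "\<infinity>" \<eta>] cont
    by (auto simp: continuous_on_eq_continuous_at)
  define \<phi> where "\<phi> x = F x - F 0" for x
  have \<phi>: "(\<phi> has_vector_derivative \<eta> x) (at x)" for x
    unfolding \<phi>_def using F[of x] by (auto intro!: derivative_eq_intros)
  have der: "deriv \<phi> = \<eta>"
    using \<phi> by (auto intro!: ext DERIV_imp_deriv simp: has_real_derivative_iff_has_vector_derivative)
  have ftc: "(\<eta> has_integral \<phi> b - \<phi> a) {a..b}" if "a \<le> b" for a b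
    using that \<phi> by (intro fundamental_theorem_of_calculus) (auto intro: has_vector_derivative_at_within)
  have const: "\<phi> a = \<phi> b" if "a \<le> b" "{a<..<b} \<inter> {p..q} = {}" for a b
  proof -
    have "(\<eta> has_integral 0) {a..b}"
    proof (rule has_integral_spike_finite[where f = "\<lambda>_. 0" and S = "{a, b}"])
      fix x assume "x \<in> {a..b} - {a, b}"
      then have "x \<in> {a<..<b}" by auto
      then have "x \<notin> {p..q}" using that(2) by blast
      then show "\<eta> x = 0" by (rule supp)
    qed auto
    then have "\<phi> b - \<phi> a = 0" by (rule has_integral_unique[OF ftc[OF that(1)]])
    then show ?thesis by simp
  qed
  have "integrable (lebesgue_on {0..L}) \<eta>"
    using cont continuous_on_subset by (intro continuous_imp_integrable_real) blast
  then have "\<phi> L - \<phi> 0 = (LINT x|lebesgue_on {0..L}. \<eta> x)"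
    using ftc[of 0 L] L by (simp add: lebesgue_integral_eq_integral integral_unique)
  also have "\<dots> = (LINT x|lebesgue_on (Omega L). \<eta> x)"
    using pq supp by (subst (1 2) integral_restrict_space)
      (auto simp: Omega_def intro!: Bochner_Integration.integral_cong split: split_indicator)
  finally have \<phi>L: "\<phi> L = 0" using zero by (simp add: \<phi>_def)
  have "\<phi> x = 0" if "x \<notin> {p..q}" for x
  proof (cases "x < p")
    case True
    \<comment> \<open>Comparing with the smaller of the two points treats both orders of
      \<open>x\<close> and 0 at once; \<open>max x L\<close> does the same on the right.\<close>
    have "\<phi> x = \<phi> (min x 0)" "\<phi> 0 = \<phi> (min x 0)"
      by (rule const[symmetric]; use True pq in \<open>auto simp: disjoint_iff\<close>)+
    then show ?thesis by (simp add: \<phi>_def)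
  next
    case False
    have "\<phi> x = \<phi> (max x L)" "\<phi> L = \<phi> (max x L)"
      by (rule const; use False that pq in \<open>auto simp: disjoint_iff\<close>)+
    then show ?thesis using \<phi>L by simp
  qed
  moreover have "{p..q} \<subseteq> Omega L" using pq by (auto simp: Omega_def)
  ultimately have "\<exists>K. compact K \<and> K \<subseteq> Omega L \<and> (\<forall>x. x \<notin> K \<longrightarrow> \<phi> x = 0)"
    by (intro exI[of _ "{p..q}"]) auto
  with \<phi> cont have "test_function L \<phi>"
    by (auto simp: test_function_def C1_differentiable_on_def)
  then show ?thesis using that der by blast
qed

text \<open>
  Subtracting a multiple of a fixed bump \<open>\<psi>0\<close> makes any admissible \<open>\<psi>\<close> have mean zero, hence the
  derivative of a test function. So \<open>h - c\<close> is orthogonal to all such \<open>\<psi>\<close>, and trapezoidal \<open>\<psi>\<close>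
  approximate the indicator functions of \<open>(0, a)\<close>.
\<close>

lemma du_Bois_Reymond:
  fixes h :: "real \<Rightarrow> real"
  assumes L: "L > 0" and h: "integrable (lebesgue_on (Omega L)) h"
    and zero: "\<And>\<phi>. test_function L \<phi> \<Longrightarrow> (LINT x|lebesgue_on (Omega L). h x * deriv \<phi> x) = 0"
  obtains c where "AE x in lebesgue_on (Omega L). h x = c"
proof -
  let ?M = "lebesgue_on (Omega L)"
  \<comment> \<open>A tent with peak at \<open>L/2\<close>, supported in the middle half of the
    interval. It is continuous, nonnegative and not identically zero, hence its integral
    \<open>I\<close> is nonzero.\<close>
  define \<psi>0 where "\<psi>0 x = max 0 (min (x - L/4) (3*L/4 - x))" for x
  have cont0: "continuous_on UNIV \<psi>0" unfolding \<psi>0_def by (intro continuous_intros)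
  have supp0: "\<psi>0 x = 0" if "x \<notin> {L/4..3*L/4}" for x using that by (auto simp: \<psi>0_def)
  have int_cont: "integrable ?M \<psi>" if "continuous_on UNIV \<psi>" for \<psi> :: "real \<Rightarrow> real"
    using integrable_mult_continuous[OF integrable_const_Omega[of L 1] continuous_on_subset[OF that]] by simp
  have int_h: "integrable ?M (\<lambda>x. h x * \<psi> x)" if "continuous_on UNIV \<psi>" for \<psi> :: "real \<Rightarrow> real"
    using integrable_mult_continuous[OF h continuous_on_subset[OF that]] by simp
  define I where "I = (LINT x|?M. \<psi>0 x)"
  have "I \<noteq> 0"
  proof
    assume "I = 0"
    moreover have "I = integral {0..L} \<psi>0"
    proof -
      have "I = (LINT x|lebesgue_on {0..L}. \<psi>0 x)"
        unfolding I_def using L supp0 by (subst (1 2) integral_restrict_space)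
          (auto simp: Omega_def intro!: Bochner_Integration.integral_cong split: split_indicator)
      then show ?thesis
        using cont0 continuous_on_subset
        by (subst lebesgue_integral_eq_integral[symmetric])
           (auto intro!: continuous_imp_integrable_real)
    qed
    ultimately have "\<forall>x\<in>{0..L}. \<psi>0 x = 0"
      using integral_eq_0_iff[of 0 L \<psi>0] L continuous_on_subset[OF cont0] by (auto simp: \<psi>0_def)
    then have "\<psi>0 (L/2) = 0" using L by auto
    then show False using L by (auto simp: \<psi>0_def)
  qed
  \<comment> \<open>If \<open>h\<close> is constant, testing against \<open>\<psi>0\<close> forces
    the constant to be this quotient.\<close>
  define c where "c = (LINT x|?M. h x * \<psi>0 x) / I"
  have int0: "(LINT x|?M. (h x - c) * \<psi> x) = 0"
    if cont: "continuous_on UNIV \<psi>" and pq: "0 < p" "p \<le> q" "q < L"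
      and supp: "\<And>x. x \<notin> {p..q} \<Longrightarrow> \<psi> x = 0" for \<psi> p q
  proof -
    define k where "k = (LINT x|?M. \<psi> x) / I"
    define \<eta> where "\<eta> x = \<psi> x - k * \<psi>0 x" for x
    have "(LINT x|?M. \<eta> x) = (LINT x|?M. \<psi> x) - k * I"
      unfolding \<eta>_def I_def using int_cont[OF cont] int_cont[OF cont0] by simp
    then have "(LINT x|?M. \<eta> x) = 0" using \<open>I \<noteq> 0\<close> by (simp add: k_def)
    moreover have "continuous_on UNIV \<eta>" unfolding \<eta>_def by (intro continuous_intros cont cont0)
    \<comment> \<open>The supports of \<open>\<psi>\<close> and \<open>\<psi>0\<close> need not be
      nested; the smallest interval containing both is still compact inside the open
      interval.\<close>
    moreover have "\<eta> x = 0" if "x \<notin> {min p (L/4)..max q (3*L/4)}" for x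
    proof -
      have "x \<notin> {p..q}" "x \<notin> {L/4..3*L/4}" using that by auto
      then show ?thesis by (simp add: \<eta>_def supp supp0)
    qed
    moreover have "min p (L/4) \<le> max q (3*L/4)" using pq by linarith
    ultimately obtain \<phi> where "test_function L \<phi>" "deriv \<phi> = \<eta>"
      using test_function_antiderivative[of L \<eta> "min p (L/4)" "max q (3*L/4)"] L pq by auto
    then have "0 = (LINT x|?M. h x * \<eta> x)" using zero by metis
    also have "\<dots> = (LINT x|?M. h x * \<psi> x - k * (h x * \<psi>0 x))"
      by (simp add: \<eta>_def algebra_simps)
    also have "\<dots> = (LINT x|?M. h x * \<psi> x) - k * (LINT x|?M. h x * \<psi>0 x)"
      using int_h[OF cont] int_h[OF cont0] by simp
    also have "\<dots> = (LINT x|?M. h x * \<psi> x) - c * (LINT x|?M. \<psi> x)"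
      by (simp add: k_def c_def)
    also have "\<dots> = (LINT x|?M. (h x - c) * \<psi> x)"
      using int_h[OF cont] int_cont[OF cont] by (simp add: left_diff_distrib)
    finally show ?thesis ..
  qed
  have hc: "integrable ?M (\<lambda>x. h x - c)" using h integrable_const_Omega by auto
  have "(LINT x|?M. indicator {..<a} x * (h x - c)) = 0" if a: "a \<in> {0<..<L}" for a
  proof -
    \<comment> \<open>For positive \<open>n\<close> the function is 0 up to \<open>1/n\<close> and
      from \<open>a\<close> on; for large \<open>n\<close> it is 1 between \<open>2/n\<close> and
      \<open>a - 1/n\<close>. The shift by \<open>1/n\<close> keeps the support away from 0, as
      \<open>int0\<close> demands.\<close>
    define \<psi> where "\<psi> n x = max 0 (min 1 (min (real n * x - 1) (real n * (a - x))))" for n x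
    have cont: "continuous_on UNIV (\<psi> n)" for n unfolding \<psi>_def by (intro continuous_intros)
    have ev0: "\<forall>\<^sub>F n in sequentially. (LINT x|?M. (h x - c) * \<psi> n x) = 0"
    \<comment> \<open>Beyond this threshold the support interval \<open>{1 / real n..a}\<close> has
      its endpoints in the right order.\<close>
    proof (rule eventually_mono[OF eventually_gt_at_top[of "nat \<lceil>1/a\<rceil>"]])
      fix n assume "nat \<lceil>1/a\<rceil> < n"
      then have "1/a < real n" by linarith
      moreover have "0 < 1/a" using a by simp
      ultimately have "0 < real n" by linarith
      with \<open>1/a < real n\<close> have n: "0 < real n" "1 / real n \<le> a" using a by (auto simp: field_simps)
      show "(LINT x|?M. (h x - c) * \<psi> n x) = 0"
      proof (rule int0[where p = "1 / real n" and q = a, OF cont])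
        fix x assume "x \<notin> {1 / real n..a}"
        then have "real n * x - 1 \<le> 0 \<or> real n * (a - x) \<le> 0"
          using n by (auto simp: field_simps not_le intro: mult_left_mono)
        then show "\<psi> n x = 0" by (auto simp: \<psi>_def)
      qed (use n a in auto)
    qed
    have "(\<lambda>n. LINT x|?M. (h x - c) * \<psi> n x) \<longlonglongrightarrow> (LINT x|?M. indicator {..<a} x * (h x - c))"
    proof (rule integral_dominated_convergence[where w = "\<lambda>x. \<bar>h x - c\<bar>"])
      show "AE x in ?M. (\<lambda>n. (h x - c) * \<psi> n x) \<longlonglongrightarrow> indicator {..<a} x * (h x - c)"
      proof (rule AE_I2)
        fix x assume "x \<in> space ?M"
        then have x: "0 < x" by (auto simp: Omega_def)
        have "\<forall>\<^sub>F n in sequentially. (h x - c) * \<psi> n x = indicator {..<a} x * (h x - c)"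
        proof (cases "x < a")
          case True
          \<comment> \<open>Past \<open>m\<close> both ramps are at least 1 at \<open>x\<close>: the
            rising one by \<open>2/x\<close>, where the 2 absorbs the shift, and the falling one by
            \<open>1/(a - x)\<close>.\<close>
          define m where "m = max (2/x) (1/(a - x))"
          show ?thesis
          proof (rule eventually_mono[OF eventually_gt_at_top[of "nat \<lceil>m\<rceil>"]])
            fix n assume "nat \<lceil>m\<rceil> < n"
            then have "m < real n" by linarith
            then have "2/x < real n" "1/(a - x) < real n" by (auto simp: m_def)
            then have "2 \<le> real n * x" "1 \<le> real n * (a - x)" using x True by (auto simp: field_simps)
            then show "(h x - c) * \<psi> n x = indicator {..<a} x * (h x - c)"
              using True by (auto simp: \<psi>_def)
          qed
        next
          case False
          then have "real n * (a - x) \<le> 0" for n by (auto intro: mult_nonneg_nonpos)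
          then have "\<psi> n x = 0" for n unfolding \<psi>_def by (smt (verit))
          then show ?thesis using False by auto
        qed
        then show "(\<lambda>n. (h x - c) * \<psi> n x) \<longlonglongrightarrow> indicator {..<a} x * (h x - c)"
          by (rule tendsto_eventually)
      qed
      show "AE x in ?M. norm ((h x - c) * \<psi> n x) \<le> \<bar>h x - c\<bar>" for n
        by (auto simp: \<psi>_def abs_mult intro!: mult_left_le)
      show "(\<lambda>x. (h x - c) * \<psi> n x) \<in> borel_measurable ?M" for n
        using hc measurable_continuous_Omega[OF continuous_on_subset[OF cont[of n]]] by auto
    qed (use hc integrable_cut[OF hc] in auto)
    moreover have "(\<lambda>n. LINT x|?M. (h x - c) * \<psi> n x) \<longlonglongrightarrow> 0"
      using ev0 by (rule tendsto_eventually)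
    ultimately show ?thesis using LIMSEQ_unique by blast
  qed
  then have "AE x in ?M. h x - c = 0"
    using hc by (intro AE_zero_if_integrals_zero[of 0 L, folded Omega_def]) (auto simp: Omega_def)
  then show ?thesis using that[of c] by auto
qed

section \<open>Square integrable functions on the interval\<close>

lemma L2_integrable:
  assumes "f \<in> L2_space L"
  shows "integrable (lebesgue_on (Omega L)) f"
  using assms finite_measure.square_integrable_imp_integrable[OF finite_measure_Omega]
  by (auto simp: L2_space_def)

lemma L2_measurable: "f \<in> L2_space L \<Longrightarrow> f \<in> borel_measurable (lebesgue_on (Omega L))"
  by (simp add: L2_space_def)

lemma L2_integrable_mult:
  assumes "f \<in> L2_space L" "h \<in> L2_space L"
  shows "integrable (lebesgue_on (Omega L)) (\<lambda>x. f x * h x)"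
proof (rule Bochner_Integration.integrable_bound[where f = "\<lambda>x. (f x)\<^sup>2 + (h x)\<^sup>2"])
  have "\<bar>a * b\<bar> \<le> a\<^sup>2 + b\<^sup>2" for a b :: real
    using sum_squares_bound[of "\<bar>a\<bar>" "\<bar>b\<bar>"] mult_nonneg_nonneg[of "\<bar>a\<bar>" "\<bar>b\<bar>"]
    unfolding abs_mult power2_abs by linarith
  then show "AE x in lebesgue_on (Omega L). norm (f x * h x) \<le> norm ((f x)\<^sup>2 + (h x)\<^sup>2)"
    by simp
qed (use assms in \<open>auto simp: L2_space_def\<close>)

lemma L2_scale: "f \<in> L2_space L \<Longrightarrow> (\<lambda>x. a * f x) \<in> L2_space L"
  by (auto simp: L2_space_def power_mult_distrib intro: borel_measurable_times)

lemma L2_const: "(\<lambda>x. b) \<in> L2_space L"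
  by (simp add: L2_space_def integrable_const_Omega)

lemma L2_add:
  assumes f: "f \<in> L2_space L" and h: "h \<in> L2_space L"
  shows "(\<lambda>x. f x + h x) \<in> L2_space L"
proof -
  have "integrable (lebesgue_on (Omega L)) (\<lambda>x. (f x)\<^sup>2 + (h x)\<^sup>2 + 2 * (f x * h x))"
    using f h L2_integrable_mult[OF f h] by (intro Bochner_Integration.integrable_add) (auto simp: L2_space_def)
  then show ?thesis using f h
    by (auto simp: L2_space_def power2_sum mult.assoc intro: borel_measurable_add)
qed

lemma L2_affine: "f \<in> L2_space L \<Longrightarrow> (\<lambda>x. a * f x + b) \<in> L2_space L"
  by (intro L2_add L2_scale L2_const)

text \<open>Cauchy-Schwarz against the constant 1, obtained by expanding the nonnegative integral of
  \<open>(\<bar>w x\<bar> - m)\<^sup>2\<close> with \<open>m\<close> the mean of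
  \<open>\<bar>w\<bar>\<close>.\<close>

lemma square_integral_abs_le:
  assumes L: "L > 0" and w: "w \<in> L2_space L"
  shows "(LINT x|lebesgue_on (Omega L). \<bar>w x\<bar>)\<^sup>2 \<le> L * (LINT x|lebesgue_on (Omega L). (w x)\<^sup>2)"
proof -
  let ?M = "lebesgue_on (Omega L)"
  define m where "m = (LINT x|?M. \<bar>w x\<bar>) / L"
  have meas: "measure ?M (space ?M) = L"
    using L by (simp add: measure_restrict_space Omega_def)
  have i: "integrable ?M (\<lambda>x. \<bar>w x\<bar>)" "integrable ?M (\<lambda>x. (w x)\<^sup>2)"
    using w L2_integrable[OF w] by (auto simp: L2_space_def)
  have "0 \<le> (LINT x|?M. (\<bar>w x\<bar> - m)\<^sup>2)" by simp
  also have "\<dots> = (LINT x|?M. (w x)\<^sup>2 - (2 * m) * \<bar>w x\<bar> + m\<^sup>2)"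
    by (simp add: power2_diff algebra_simps)
  also have "\<dots> = (LINT x|?M. (w x)\<^sup>2) - 2 * m * (LINT x|?M. \<bar>w x\<bar>) + m\<^sup>2 * L"
    using i meas integrable_const_Omega by simp
  finally show ?thesis
    using L by (simp add: m_def field_simps power2_eq_square)
qed

text \<open>The bound is uniform in \<open>x\<close> because cutting off can only decrease
  \<open>\<bar>w\<bar>\<close>. It is the pointwise form of the Poincare inequality.\<close>

lemma square_primitive_le:
  assumes L: "L > 0" and w: "w \<in> L2_space L"
  shows "(primitive L w x)\<^sup>2 \<le> L * (LINT x|lebesgue_on (Omega L). (w x)\<^sup>2)"
proof -
  note i = L2_integrable[OF w]
  have "\<bar>primitive L w x\<bar> \<le> (LINT s|lebesgue_on (Omega L). \<bar>indicator {..<x} s * w s\<bar>)"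
    unfolding primitive_def using integral_abs_bound by blast
  also have "\<dots> \<le> (LINT s|lebesgue_on (Omega L). \<bar>w s\<bar>)"
    using i integrable_cut[OF i] by (intro integral_mono) (auto split: split_indicator)
  finally have "(primitive L w x)\<^sup>2 \<le> (LINT s|lebesgue_on (Omega L). \<bar>w s\<bar>)\<^sup>2"
    by (metis abs_ge_zero power2_abs power_mono)
  then show ?thesis using square_integral_abs_le[OF L w] by linarith
qed

lemma primitive_0: "primitive L w 0 = 0"
proof -
  have "primitive L w 0 = (LINT s|lebesgue_on (Omega L). 0)"
    unfolding primitive_def by (rule Bochner_Integration.integral_cong) (auto simp: Omega_def)
  then show ?thesis by simp
qed

lemma primitive_scale: "primitive L (\<lambda>s. a * w s) x = a * primitive L w x"
  by (simp add: primitive_def mult.left_commute[of _ a])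

section \<open>Weak derivatives, continuous representatives and point values\<close>

text \<open>Integration by parts makes \<open>u - primitive L w\<close> orthogonal to all
  derivatives of test functions, so it is constant by du Bois-Reymond. Conversely, a constant
  contributes nothing, since the derivative of a test function has mean zero.\<close>

lemma weak_derivative_iff:
  assumes L: "L > 0" and u: "u \<in> L2_space L"
  shows "is_weak_derivative L u w \<longleftrightarrow>
    w \<in> L2_space L \<and> (\<exists>c. AE x in lebesgue_on (Omega L). u x = c + primitive L w x)"
proof (intro iffI conjI)
  let ?M = "lebesgue_on (Omega L)"
  assume uw: "is_weak_derivative L u w"
  then show w: "w \<in> L2_space L" by (simp add: is_weak_derivative_def)
  note W = continuous_on_subset[OF continuous_primitive[OF L2_integrable[OF w]]]
  have "integrable ?M (primitive L w)"
    using integrable_mult_continuous[OF integrable_const_Omega[of L 1] W] by simp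
  then have h: "integrable ?M (\<lambda>x. u x - primitive L w x)" using L2_integrable[OF u] by auto
  obtain c where "AE x in ?M. u x - primitive L w x = c"
  proof (rule du_Bois_Reymond[OF L h])
    fix \<phi> assume \<phi>: "test_function L \<phi>"
    have d: "continuous_on {0..L} (deriv \<phi>)"
      using test_function_deriv(2)[OF \<phi>] continuous_on_subset by blast
    have "(LINT x|?M. (u x - primitive L w x) * deriv \<phi> x)
        = (LINT x|?M. u x * deriv \<phi> x) - (LINT x|?M. primitive L w x * deriv \<phi> x)"
      using integrable_mult_continuous[OF L2_integrable[OF u] d]
        integrable_mult_continuous[OF \<open>integrable ?M (primitive L w)\<close> d]
      by (simp add: left_diff_distrib)
    then show "(LINT x|?M. (u x - primitive L w x) * deriv \<phi> x) = 0"
      using uw \<phi> integral_primitive_deriv[OF \<phi> L2_integrable[OF w]]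
      by (simp add: is_weak_derivative_def L2_inner_def)
  qed
  then have "AE x in ?M. u x = c + primitive L w x" by eventually_elim simp
  then show "\<exists>c. AE x in ?M. u x = c + primitive L w x" ..
next
  let ?M = "lebesgue_on (Omega L)"
  assume "w \<in> L2_space L \<and> (\<exists>c. AE x in ?M. u x = c + primitive L w x)"
  then obtain c where w: "w \<in> L2_space L" and c: "AE x in ?M. u x = c + primitive L w x" by blast
  note W = continuous_on_subset[OF continuous_primitive[OF L2_integrable[OF w]]]
  have iW: "integrable ?M (primitive L w)"
    using integrable_mult_continuous[OF integrable_const_Omega[of L 1] W] by simp
  have "L2_inner L u (deriv \<phi>) = - L2_inner L w \<phi>" if \<phi>: "test_function L \<phi>" for \<phi>
  proof -
    have d: "continuous_on {0..L} (deriv \<phi>)"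
      using test_function_deriv(2)[OF \<phi>] continuous_on_subset by blast
    note i = integrable_mult_continuous[OF integrable_const_Omega[of L c] d]
      integrable_mult_continuous[OF iW d]
    \<comment> \<open>A cut-off at 0 changes nothing on \<open>Omega L\<close> and turns the mean
      into a tail integral, with value \<open>- \<phi> 0 = 0\<close>.\<close>
    have "(LINT x|?M. deriv \<phi> x) = (LINT x|?M. indicator {0<..} x * deriv \<phi> x)"
      by (rule Bochner_Integration.integral_cong) (auto simp: Omega_def)
    then have "(LINT x|?M. deriv \<phi> x) = 0"
      using integral_deriv_tail[OF \<phi>, of 0] test_function_outside[OF \<phi>, of 0] L
      by (simp add: Omega_def)
    then have "(LINT x|?M. c * deriv \<phi> x + primitive L w x * deriv \<phi> x)
        = - (LINT x|?M. w x * \<phi> x)"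
      using i integral_primitive_deriv[OF \<phi> L2_integrable[OF w]] by simp
    moreover have "(LINT x|?M. u x * deriv \<phi> x)
        = (LINT x|?M. c * deriv \<phi> x + primitive L w x * deriv \<phi> x)"
    proof (rule integral_cong_AE)
      show "AE x in ?M. u x * deriv \<phi> x = c * deriv \<phi> x + primitive L w x * deriv \<phi> x"
        using c by eventually_elim (simp add: algebra_simps)
      show "(\<lambda>x. u x * deriv \<phi> x) \<in> borel_measurable ?M"
        using L2_measurable[OF u] measurable_continuous_Omega[OF d] by simp
      show "(\<lambda>x. c * deriv \<phi> x + primitive L w x * deriv \<phi> x) \<in> borel_measurable ?M"
        using i by auto
    qed
    ultimately show ?thesis by (simp add: L2_inner_def)
  qed
  then show "is_weak_derivative L u w" using w by (simp add: is_weak_derivative_def)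
qed

text \<open>The continuous function \<open>\<bar>f x - h x\<bar>\<close> has zero integral over the
  closed interval, whose endpoints are null. The conclusion reaches those endpoints, which is where
  boundary values are read off.\<close>

lemma continuous_AE_eq:
  fixes f h :: "real \<Rightarrow> real"
  assumes L: "L > 0" and f: "continuous_on {0..L} f" and h: "continuous_on {0..L} h"
    and ae: "AE x in lebesgue_on (Omega L). f x = h x" and x: "x \<in> {0..L}"
  shows "f x = h x"
proof -
  have c: "continuous_on {0..L} (\<lambda>x. \<bar>f x - h x\<bar>)" using f h by (intro continuous_intros)
  have "AE x in lebesgue. x \<in> Omega L \<longrightarrow> f x = h x"
    using ae by (subst (asm) AE_restrict_space_iff) auto
  moreover have "AE x in lebesgue. x \<noteq> 0" "AE x in lebesgue. x \<noteq> L"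
    by (simp_all add: completion.AE_iff_null_sets)
  ultimately have "AE x in lebesgue. x \<in> {0..L} \<longrightarrow> \<bar>f x - h x\<bar> = 0"
    by eventually_elim (auto simp: Omega_def)
  then have "AE x in lebesgue_on {0..L}. \<bar>f x - h x\<bar> = 0"
    by (subst AE_restrict_space_iff) auto
  then have "(LINT x|lebesgue_on {0..L}. \<bar>f x - h x\<bar>) = 0"
    by (rule integral_eq_zero_AE)
  then show ?thesis using integralL_eq_0_iff[OF c L] x by auto
qed

text \<open>Resolves the description operator in \<open>pt_value\<close>: any two continuous
  representatives agree on the closed interval.\<close>

lemma pt_value_eq:
  assumes L: "L > 0" and w: "continuous_on {0..L} w"
    and ae: "AE x in lebesgue_on (Omega L). u x = w x" and a: "a \<in> {0..L}"
  shows "pt_value L u a = w a"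
  unfolding pt_value_def
proof (rule the_equality)
  fix y assume "\<exists>w. continuous_on {0..L} w \<and> (AE x in lebesgue_on (Omega L). u x = w x) \<and> w a = y"
  then obtain v where v: "continuous_on {0..L} v" "AE x in lebesgue_on (Omega L). u x = v x" "v a = y"
    by blast
  have "AE x in lebesgue_on (Omega L). v x = w x" using v(2) ae by eventually_elim simp
  then show "y = w a" using continuous_AE_eq[OF L v(1) w _ a] v(3) by simp
qed (use w ae in blast)

text \<open>Uniqueness of weak derivatives, needed because \<open>dx\<close> is an arbitrary choice.
  Continuity upgrades the hypothesis to all points; at 0 the constants agree, and then all initial
  integrals of \<open>w1 - w2\<close> vanish.\<close>

lemma AE_eq_if_primitive_eq:
  assumes L: "L > 0"
    and i: "integrable (lebesgue_on (Omega L)) w1" "integrable (lebesgue_on (Omega L)) w2"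
    and ae: "AE x in lebesgue_on (Omega L). c1 + primitive L w1 x = c2 + primitive L w2 x"
  shows "AE x in lebesgue_on (Omega L). w1 x = w2 x"
proof -
  let ?M = "lebesgue_on (Omega L)"
  have eq: "c1 + primitive L w1 x = c2 + primitive L w2 x" if "x \<in> {0..L}" for x
    by (rule continuous_AE_eq[OF L _ _ ae that])
       (auto intro!: continuous_intros continuous_on_subset[OF continuous_primitive] i)
  have "c1 = c2" using eq[of 0] L by (simp add: primitive_0)
  have "(LINT s|?M. indicator {..<a} s * (w1 s - w2 s)) = 0" if "a \<in> {0<..<L}" for a
  proof -
    have "(LINT s|?M. indicator {..<a} s * (w1 s - w2 s)) = primitive L w1 a - primitive L w2 a"
      using integrable_cut[OF i(1)] integrable_cut[OF i(2)]
      by (simp add: primitive_def right_diff_distrib)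
    then show ?thesis using eq[of a] that \<open>c1 = c2\<close> by simp
  qed
  then have "AE x in ?M. w1 x - w2 x = 0"
    using i by (intro AE_zero_if_integrals_zero[of 0 L, folded Omega_def]) (auto simp: Omega_def)
  then show ?thesis by simp
qed

lemma H1_weak_derivative: "u \<in> H1_space L \<Longrightarrow> is_weak_derivative L u (dx L u)"
  by (simp add: dx_def H1_space_def someI_ex)

lemma dx_L2: "u \<in> H1_space L \<Longrightarrow> dx L u \<in> L2_space L"
  using H1_weak_derivative by (auto simp: is_weak_derivative_def)

text \<open>The primitive vanishes at 0, so the constant of integration is the boundary value
  there.\<close>

lemma H1_representation:
  assumes L: "L > 0" and u: "u \<in> H1_space L"
  shows "AE x in lebesgue_on (Omega L). u x = pt_value L u 0 + primitive L (dx L u) x"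
proof -
  have u2: "u \<in> L2_space L" using u by (simp add: H1_space_def)
  obtain c where c: "AE x in lebesgue_on (Omega L). u x = c + primitive L (dx L u) x"
    using H1_weak_derivative[OF u] weak_derivative_iff[OF L u2] by blast
  have "pt_value L u 0 = c + primitive L (dx L u) 0"
    using L c by (intro pt_value_eq)
      (auto intro!: continuous_intros continuous_on_subset[OF continuous_primitive] L2_integrable dx_L2 u)
  then show ?thesis using c by (simp add: primitive_0)
qed

text \<open>An affine map acts on the representation of \<open>u\<close> by a constant and a
  primitive, which yields membership and the value at 0. The derivative is only determined almost
  everywhere, by comparing two such representations of the same function.\<close>

lemma H1_affine:
  assumes L: "L > 0" and u: "u \<in> H1_space L"
  shows "(\<lambda>x. a * u x + b) \<in> H1_space L"
    and "pt_value L (\<lambda>x. a * u x + b) 0 = a * pt_value L u 0 + b"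
    and "AE x in lebesgue_on (Omega L). dx L (\<lambda>x. a * u x + b) x = a * dx L u x"
proof -
  let ?M = "lebesgue_on (Omega L)" and ?y = "\<lambda>x. a * u x + b"
  let ?w = "\<lambda>x. a * dx L u x" and ?c = "a * pt_value L u 0 + b"
  have y: "?y \<in> L2_space L" using u by (intro L2_affine) (simp add: H1_space_def)
  have w: "?w \<in> L2_space L" by (intro L2_scale dx_L2 u)
  have rep: "AE x in ?M. ?y x = ?c + primitive L ?w x"
    using H1_representation[OF L u] by eventually_elim (simp add: primitive_scale algebra_simps)
  then have wd: "is_weak_derivative L ?y ?w"
    using weak_derivative_iff[OF L y] w by blast
  then show H1: "?y \<in> H1_space L" using y by (auto simp: H1_space_def)
  have "pt_value L ?y 0 = ?c + primitive L ?w 0"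
    using L rep by (intro pt_value_eq)
      (auto intro!: continuous_intros continuous_on_subset[OF continuous_primitive] L2_integrable w)
  then show "pt_value L ?y 0 = ?c" by (simp add: primitive_0)
  have "AE x in ?M. pt_value L ?y 0 + primitive L (dx L ?y) x = ?c + primitive L ?w x"
    using rep H1_representation[OF L H1] by eventually_elim simp
  then show "AE x in ?M. dx L ?y x = ?w x"
    by (rule AE_eq_if_primitive_eq[OF L L2_integrable[OF dx_L2[OF H1]] L2_integrable[OF w]])
qed

lemma integral_square_dx_affine:
  assumes L: "L > 0" and u: "u \<in> H1_space L"
  shows "(LINT x|lebesgue_on (Omega L). (dx L (\<lambda>x. a * u x + b) x)\<^sup>2)
       = a\<^sup>2 * (LINT x|lebesgue_on (Omega L). (dx L u x)\<^sup>2)"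
proof -
  have "(LINT x|lebesgue_on (Omega L). (dx L (\<lambda>x. a * u x + b) x)\<^sup>2)
      = (LINT x|lebesgue_on (Omega L). a\<^sup>2 * (dx L u x)\<^sup>2)"
  proof (rule integral_cong_AE)
    show "AE x in lebesgue_on (Omega L). (dx L (\<lambda>x. a * u x + b) x)\<^sup>2 = a\<^sup>2 * (dx L u x)\<^sup>2"
      using H1_affine(3)[OF L u, of a b] by eventually_elim (simp add: power_mult_distrib)
  qed (use dx_L2[OF u] dx_L2[OF H1_affine(1)[OF L u]] in \<open>auto simp: L2_space_def\<close>)
  then show ?thesis by simp
qed

section \<open>The Poincare inequality\<close>

text \<open>One factor \<open>L\<close> comes from the uniform bound on the primitive of
  \<open>dx L u\<close>, the other from integrating that bound over an interval of length
  \<open>L\<close>.\<close>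

lemma Poincare_inequality:
  assumes L: "L > 0" and u: "u \<in> H1_space L"
  shows "(LINT x|lebesgue_on (Omega L). (u x - pt_value L u 0)\<^sup>2)
       \<le> L\<^sup>2 * (LINT x|lebesgue_on (Omega L). (dx L u x)\<^sup>2)"
proof -
  let ?M = "lebesgue_on (Omega L)"
  let ?K = "L * (LINT x|?M. (dx L u x)\<^sup>2)"
  have meas: "measure ?M (space ?M) = L"
    using L by (simp add: measure_restrict_space Omega_def)
  have "(\<lambda>x. 1 * u x + (- pt_value L u 0)) \<in> L2_space L"
    using u by (intro L2_affine) (simp add: H1_space_def)
  then have "integrable ?M (\<lambda>x. (u x - pt_value L u 0)\<^sup>2)" by (simp add: L2_space_def)
  then have "(LINT x|?M. (u x - pt_value L u 0)\<^sup>2) \<le> (LINT x|?M. ?K)"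
  proof (rule integral_mono_AE[OF _ integrable_const_Omega])
    show "AE x in ?M. (u x - pt_value L u 0)\<^sup>2 \<le> ?K"
      using H1_representation[OF L u]
      by eventually_elim (use square_primitive_le[OF L dx_L2[OF u]] in simp)
  qed
  also have "\<dots> = L * ?K" using meas by simp
  finally show ?thesis by (simp add: power2_eq_square mult.assoc)
qed

section \<open>Norms and energy of states\<close>

lemma inner_V_self_nonneg: "0 \<le> inner_V L u u"
  by (simp add: inner_V_def L2_inner_def)

lemma inner_H_self_nonneg: "0 \<le> inner_H L v v"
  by (simp add: inner_H_def L2_inner_def)

lemma norm_HH_square: "(norm_HH L X)\<^sup>2 = inner_V L (fst X) (fst X) + inner_H L (snd X) (snd X)"
  by (simp add: norm_HH_def norm_V_def norm_H_def inner_V_self_nonneg inner_H_self_nonneg)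

lemma norm_HH_nonneg: "0 \<le> norm_HH L X"
  by (simp add: norm_HH_def)

lemma inner_H_scale: "inner_H L (\<lambda>x. a * v x, a * \<theta>) (\<lambda>x. a * v x, a * \<theta>) = a\<^sup>2 * inner_H L (v, \<theta>) (v, \<theta>)"
proof -
  have "L2_inner L (\<lambda>x. a * v x) (\<lambda>x. a * v x) = (LINT x|lebesgue_on (Omega L). a\<^sup>2 * (v x * v x))"
    unfolding L2_inner_def by (rule Bochner_Integration.integral_cong) (auto simp: power2_eq_square)
  then show ?thesis by (simp add: inner_H_def L2_inner_def power2_eq_square algebra_simps)
qed

lemma energy_eq:
  "energy L u v = ((LINT x|lebesgue_on (Omega L). (dx L (fst u) x)\<^sup>2) + inner_H L v v) / 2"
  by (simp add: energy_def norm_H_def inner_H_self_nonneg)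

section \<open>Distance to the energy ball\<close>

lemma shrinking_factor:
  fixes e E :: real
  assumes "0 \<le> e" "0 \<le> E"
  obtains a where "a\<^sup>2 * e \<le> E" "(1 - a)\<^sup>2 * e \<le> pos_part (e - E)"
proof (cases "e \<le> E")
  case True
  \<comment> \<open>No displacement inside the ball; this case also absorbs \<open>e = 0\<close>, so
    the quotient \<open>E / e\<close> below has a positive denominator.\<close>
  then show ?thesis using that[of 1] by (simp add: pos_part_def)
next
  case False
  define a where "a = sqrt (E / e)"
  have a: "0 \<le> a" "a \<le> 1" "a\<^sup>2 * e = E" using False assms by (auto simp: a_def)
  have "(1 - a)\<^sup>2 \<le> (1 - a) * (1 + a)"
    using a by (simp add: power2_eq_square mult_left_mono)
  then have "(1 - a)\<^sup>2 * e \<le> (1 - a\<^sup>2) * e"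
    using assms by (intro mult_right_mono) (auto simp: power2_eq_square algebra_simps)
  then show ?thesis using that[of a] a by (simp add: pos_part_def algebra_simps)
qed

text \<open>An infimum is bounded by exhibiting one element, here the shrunken state
  \<open>Y\<close>. The bound is linear in the excess energy because the squared displacement is
  controlled by \<open>(1 - a)\<^sup>2\<close> times the energy.\<close>

lemma dist_energy_ball:
  assumes L: "L > 0" and E: "0 \<le> E" and X: "(u, v) \<in> HH_space L"
  shows "(dist_HH L (u, v) (energy_ball L E))\<^sup>2 \<le> 2 * (L\<^sup>2 + 1) * pos_part (energy L u v - E)"
proof -
  let ?M = "lebesgue_on (Omega L)" and ?e = "energy L u v"
  obtain f where u: "u = (f, pt_value L f 0)" and f: "f \<in> H1_space L"
    using X by (auto simp: HH_space_def V_space_def)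
  obtain h \<theta> where v: "v = (h, \<theta>)" and h: "h \<in> L2_space L"
    using X by (auto simp: HH_space_def H_space_def)
  define D where "D = (LINT x|?M. (dx L f x)\<^sup>2)"
  have D: "0 \<le> D" by (simp add: D_def)
  have e: "2 * ?e = D + inner_H L v v" by (simp add: energy_eq u D_def)
  then have "0 \<le> ?e" using D inner_H_self_nonneg[of L v] by linarith
  then obtain a where a: "a\<^sup>2 * ?e \<le> E" "(1 - a)\<^sup>2 * ?e \<le> pos_part (?e - E)"
    using shrinking_factor E by blast
  define c where "c = pt_value L f 0"
  \<comment> \<open>Adding back \<open>(1 - a) * c\<close> keeps the value \<open>c\<close> at 0, so
    \<open>(y, c)\<close> lies in \<open>V_space L\<close>, while the derivative is simply scaled by
    \<open>a\<close>.\<close>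
  define y where "y = (\<lambda>x. a * f x + (1 - a) * c)"
  define Y :: state where "Y = ((y, c), (\<lambda>x. a * h x, a * \<theta>))"
  have y: "y \<in> H1_space L" "pt_value L y 0 = c" "(LINT x|?M. (dx L y x)\<^sup>2) = a\<^sup>2 * D"
    unfolding y_def D_def
    using H1_affine(1,2)[OF L f, of a "(1 - a) * c"] integral_square_dx_affine[OF L f, of a "(1 - a) * c"]
    by (auto simp: c_def algebra_simps)
  have "Y \<in> HH_space L"
    using y L2_scale[OF h] by (auto simp: Y_def HH_space_def V_space_def H_space_def)
  moreover have "energy L (fst Y) (snd Y) = a\<^sup>2 * ?e"
  proof -
    have "energy L (fst Y) (snd Y) = a\<^sup>2 * ((D + inner_H L v v) / 2)"
      by (simp add: energy_eq Y_def y(3) inner_H_scale v distrib_left)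
    then show ?thesis by (simp flip: e)
  qed
  ultimately have Y: "Y \<in> energy_ball L E"
    using a by (auto simp: energy_ball_def Y_def)
  \<comment> \<open>The displacement is again affine in \<open>f\<close>, so the scaling of the
    derivative applies to it. Its boundary slot is 0 because both positions take the value
    \<open>c\<close> at 0.\<close>
  have diff: "(u, v) - Y = ((\<lambda>x. (1 - a) * f x + - ((1 - a) * c), 0), (\<lambda>x. (1 - a) * h x, (1 - a) * \<theta>))"
    by (auto simp: u v Y_def y_def c_def fun_eq_iff algebra_simps)
  let ?Z = "\<lambda>x. (1 - a) * f x + - ((1 - a) * c)"
  have norm: "(norm_HH L ((u, v) - Y))\<^sup>2
      = L2_inner L ?Z ?Z + (LINT x|?M. (dx L ?Z x)\<^sup>2) + (1 - a)\<^sup>2 * inner_H L v v"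
    unfolding norm_HH_square diff
    by (simp add: inner_V_def inner_H_scale v) (simp add: L2_inner_def power2_eq_square)
  have "L2_inner L ?Z ?Z = (LINT x|?M. (1 - a)\<^sup>2 * (f x - c)\<^sup>2)"
    unfolding L2_inner_def
    by (rule Bochner_Integration.integral_cong) (auto simp: power2_eq_square algebra_simps)
  also have "\<dots> \<le> (1 - a)\<^sup>2 * (L\<^sup>2 * D)"
    using Poincare_inequality[OF L f] by (simp add: c_def D_def mult_left_mono)
  finally have "(norm_HH L ((u, v) - Y))\<^sup>2 \<le> (1 - a)\<^sup>2 * (L\<^sup>2 * D) + (1 - a)\<^sup>2 * D + (1 - a)\<^sup>2 * inner_H L v v"
    using integral_square_dx_affine[OF L f, of "1 - a" "- ((1 - a) * c)"]
    unfolding norm D_def by linarith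
  also have "\<dots> \<le> (1 - a)\<^sup>2 * (2 * (L\<^sup>2 + 1) * ?e)"
  proof -
    \<comment> \<open>The position terms carry the factor \<open>L\<^sup>2 + 1\<close> and the
      velocity term the factor 1; taking the larger for both recovers twice the energy.\<close>
    have "L\<^sup>2 * D + D + inner_H L v v \<le> (L\<^sup>2 + 1) * (D + inner_H L v v)"
      using mult_nonneg_nonneg[OF zero_le_power2[of L] inner_H_self_nonneg[of L v]]
      by (simp add: algebra_simps)
    also have "\<dots> = 2 * (L\<^sup>2 + 1) * ?e" by (simp flip: e)
    finally have "(1 - a)\<^sup>2 * (L\<^sup>2 * D + D + inner_H L v v) \<le> (1 - a)\<^sup>2 * (2 * (L\<^sup>2 + 1) * ?e)"
      by (rule mult_left_mono) simp
    then show ?thesis by (simp add: distrib_left)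
  qed
  also have "\<dots> = 2 * (L\<^sup>2 + 1) * ((1 - a)\<^sup>2 * ?e)" by simp
  also have "\<dots> \<le> 2 * (L\<^sup>2 + 1) * pos_part (?e - E)"
    using a(2) by (rule mult_left_mono) simp
  finally have "(norm_HH L ((u, v) - Y))\<^sup>2 \<le> 2 * (L\<^sup>2 + 1) * pos_part (?e - E)" .
  moreover have "dist_HH L (u, v) (energy_ball L E) \<le> norm_HH L ((u, v) - Y)"
    unfolding dist_HH_def by (rule cINF_lower[OF _ Y]) (auto intro!: bdd_belowI norm_HH_nonneg)
  \<comment> \<open>Squaring the comparison needs a nonnegative distance; the infimum runs over a
    nonempty set, since \<open>Y\<close> belongs to it.\<close>
  moreover have "0 \<le> dist_HH L (u, v) (energy_ball L E)"
    unfolding dist_HH_def using Y by (intro cINF_greatest) (auto intro: norm_HH_nonneg)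
  ultimately show ?thesis using power_mono by (meson order_trans)
qed

section \<open>Positive invariance and exponential attraction\<close>

theorem corollary1:
  fixes L :: real and g F :: "real \<Rightarrow> real" and \<alpha>1 \<alpha>2 S E_S M \<mu> :: real
  assumes "L > 0"
    and "continuous_on UNIV g" and "mono g" and "g 0 = 0"
    and "\<exists>C. C-lipschitz_on UNIV F" and "F 0 = 0" and "antimono F"
    and "0 < \<alpha>1" and "\<alpha>1 \<le> \<alpha>2" and "0 \<le> S"
    and "\<And>s. \<bar>s\<bar> \<ge> S \<Longrightarrow> \<alpha>1 * \<bar>s\<bar> \<le> \<bar>g s\<bar> \<and> \<bar>g s\<bar> \<le> \<alpha>2 * \<bar>s\<bar>"
    and "0 \<le> E_S" and "0 < M" and "0 < \<mu>"
    and "\<And>u u' t. weak_solution L g F u u' \<Longrightarrow> 0 \<le> t \<Longrightarrow>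
           pos_part (energy L (u t) (u' t) - E_S)
             \<le> M * exp (- \<mu> * t) * pos_part (energy L (u 0) (u' 0) - E_S)"
  shows "(\<forall>u u'. weak_solution L g F u u' \<longrightarrow> (u 0, u' 0) \<in> energy_ball L E_S \<longrightarrow>
            (\<forall>t\<ge>0. (u t, u' t) \<in> energy_ball L E_S)) \<and>
         (\<exists>M'>0. \<forall>u u'. weak_solution L g F u u' \<longrightarrow>
            (\<forall>t\<ge>0. (dist_HH L (u t, u' t) (energy_ball L E_S))\<^sup>2
                     \<le> M' * exp (- \<mu> * t) * pos_part (energy L (u 0) (u' 0) - E_S)))"
proof (intro conjI)
  note decay = assms(15)
  have mem: "(u t, u' t) \<in> HH_space L" if "weak_solution L g F u u'" "t \<ge> 0" for u u' t
    using that by (simp add: weak_solution_def weak_solution_Cauchy_def)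
  show "\<forall>u u'. weak_solution L g F u u' \<longrightarrow> (u 0, u' 0) \<in> energy_ball L E_S \<longrightarrow>
      (\<forall>t\<ge>0. (u t, u' t) \<in> energy_ball L E_S)"
  proof (intro allI impI)
    fix u u' t assume u: "weak_solution L g F u u'" "(u 0, u' 0) \<in> energy_ball L E_S" "0 \<le> (t::real)"
    then have "pos_part (energy L (u t) (u' t) - E_S) \<le> 0"
      using decay[OF u(1,3)] by (simp add: energy_ball_def pos_part_def)
    then show "(u t, u' t) \<in> energy_ball L E_S"
      using mem[OF u(1,3)] by (simp add: energy_ball_def pos_part_def)
  qed
  let ?C = "2 * (L\<^sup>2 + 1)"
  show "\<exists>M'>0. \<forall>u u'. weak_solution L g F u u' \<longrightarrow>
      (\<forall>t\<ge>0. (dist_HH L (u t, u' t) (energy_ball L E_S))\<^sup>2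
        \<le> M' * exp (- \<mu> * t) * pos_part (energy L (u 0) (u' 0) - E_S))"
  \<comment> \<open>\<open>?C\<close> turns excess energy into squared distance and \<open>M\<close>
    comes from the decay estimate. The conversion is linear, so the rate \<open>\<mu>\<close> is
    preserved.\<close>
  proof (intro exI[of _ "?C * M"] conjI allI impI)
    show "0 < ?C * M" using \<open>0 < M\<close> by (simp add: add_nonneg_pos)
    fix u u' t assume u: "weak_solution L g F u u'" "0 \<le> (t::real)"
    have "(dist_HH L (u t, u' t) (energy_ball L E_S))\<^sup>2 \<le> ?C * pos_part (energy L (u t) (u' t) - E_S)"
      by (rule dist_energy_ball[OF \<open>L > 0\<close> \<open>0 \<le> E_S\<close> mem[OF u]])
    also have "\<dots> \<le> ?C * (M * exp (- \<mu> * t) * pos_part (energy L (u 0) (u' 0) - E_S))"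
      by (rule mult_left_mono[OF decay[OF u]]) simp
    finally show "(dist_HH L (u t, u' t) (energy_ball L E_S))\<^sup>2
        \<le> ?C * M * exp (- \<mu> * t) * pos_part (energy L (u 0) (u' 0) - E_S)"
      by (simp only: mult.assoc)
  qed
qed

end
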